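(* There exists a nondecreasing continuous function $f\colon [0,7]\to [0,7]$ such that: (1) $f$ is not absolutely continuous on $[0,7]$; (2) its minimal modulus of continuity $\omega_f\colon[0,7]\to[0,\infty)$ is absolutely continuous on $[0,7]$.
   Context: For a continuous function $f\colon[a,b]\to\mathbb{R}$ on a compact interval, its (minimal) modulus of continuity is the function $\omega_f\colon[0,b-a]\to[0,\infty)$ defined by $\omega_f(\delta)=\max\{|f(x)-f(y)|\colon x,y\in[a,b],\ |x-y|\leq\delta\}$ for every $\delta\in[0,b-a]$. *)

theory Defs
  imports "HOL-Analysis.Analysis"
begin

text \<open>
  Functions on a compact interval are total functions on the reals of which only the
  values on the interval are used.

  Absolute continuity of a function on \<open>[a,b]\<close>, in the usual \<open>\<epsilon>\<close>-\<open>\<delta>\<close> form with finite families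
  of pairwise non-overlapping subintervals (the library constant \<open>absolutely_continuous\<close>
  is about measures).
\<close>

definition abs_continuous_on_interval :: "real \<Rightarrow> real \<Rightarrow> (real \<Rightarrow> real) \<Rightarrow> bool" where
  "abs_continuous_on_interval a b f \<longleftrightarrow>
     (\<forall>\<epsilon>>0. \<exists>\<delta>>0. \<forall>(n::nat) (u::nat \<Rightarrow> real) (v::nat \<Rightarrow> real).
        (\<forall>i<n. a \<le> u i \<and> u i < v i \<and> v i \<le> b) \<longrightarrow>
        disjoint_family_on (\<lambda>i. {u i<..<v i}) {..<n} \<longrightarrow>
        (\<Sum>i<n. v i - u i) < \<delta> \<longrightarrow>
        (\<Sum>i<n. \<bar>f (v i) - f (u i)\<bar>) < \<epsilon>)"

text \<open>
  The maximum is written as a supremum, since \<open>Max\<close> is only meaningful for finite sets;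
  the lemma below shows that it is attained for continuous \<open>f\<close> and \<open>\<delta> \<ge> 0\<close>.
\<close>

definition min_modulus :: "real \<Rightarrow> real \<Rightarrow> (real \<Rightarrow> real) \<Rightarrow> real \<Rightarrow> real" where
  "min_modulus a b f \<delta> =
     Sup {\<bar>f x - f y\<bar> | x y. x \<in> {a..b} \<and> y \<in> {a..b} \<and> \<bar>x - y\<bar> \<le> \<delta>}"

lemma min_modulus_is_maximum:
  assumes "a \<le> b" "continuous_on {a..b} f" "0 \<le> \<delta>"
  defines "D \<equiv> {\<bar>f x - f y\<bar> | x y. x \<in> {a..b} \<and> y \<in> {a..b} \<and> \<bar>x - y\<bar> \<le> \<delta>}"
  shows "min_modulus a b f \<delta> \<in> D" and "\<And>z. z \<in> D \<Longrightarrow> z \<le> min_modulus a b f \<delta>"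
proof -
  define K where "K = ({a..b} \<times> {a..b}) \<inter> {p. \<bar>fst p - snd p\<bar> \<le> \<delta>}"
  have D: "D = (\<lambda>p. \<bar>f (fst p) - f (snd p)\<bar>) ` K"
    unfolding D_def K_def by force
  have "closed {p::real \<times> real. \<bar>fst p - snd p\<bar> \<le> \<delta>}"
    by (intro closed_Collect_le continuous_intros)
  then have "compact K"
    unfolding K_def by (intro compact_Int_closed compact_Times) auto
  moreover have "continuous_on K (\<lambda>p. \<bar>f (fst p) - f (snd p)\<bar>)"
    by (intro continuous_intros continuous_on_compose2[OF assms(2)]) (auto simp: K_def)
  ultimately have "compact D"
    unfolding D by (intro compact_continuous_image)
  have "(a, a) \<in> K" using assms(1,3) by (simp add: K_def)
  then have "D \<noteq> {}" unfolding D by blast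
  have S: "min_modulus a b f \<delta> = Sup D" by (simp add: min_modulus_def D_def)
  have bdd: "bdd_above D"
    using \<open>compact D\<close> by (simp add: bounded_imp_bdd_above compact_imp_bounded)
  show "min_modulus a b f \<delta> \<in> D"
    unfolding S using \<open>compact D\<close> \<open>D \<noteq> {}\<close> bdd
    by (intro closed_contains_Sup) (auto simp: compact_imp_closed)
  show "\<And>z. z \<in> D \<Longrightarrow> z \<le> min_modulus a b f \<delta>"
    unfolding S using bdd by (rule cSup_upper[rotated])
qed

end

theory Submission
  imports Defs
begin

text \<open>
  For a nondecreasing function, \<open>\<omega> \<delta>\<close> is the largest increment over a window of length \<open>\<delta>\<close>.
  A singular piece of the function leaves a trace in \<open>\<omega>\<close> only if, for some \<open>\<delta>\<close>, every optimal
  window has an endpoint inside that piece. The construction surrounds a singular piece in such a way that, for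
  every \<open>\<delta>\<close>, some optimal window has both endpoints outside the piece.

  The singular piece \<open>cantor_fun\<close> is the Cantor function of the set that keeps the two outer
  quarters at each stage. It is \<open>1/2\<close>-Hoelder, so a multiple of the square root,
  which is absolutely continuous, dominates its increments. Scaled to height \<open>1/2\<close>, it is put on
  \<open>[7/2, 4]\<close>, and \<open>hiding_fun\<close> is completed as follows: it equals \<open>3 * sqrt x\<close> on \<open>[0, 1/4]\<close>
  (rise \<open>3/2\<close>), is constant on \<open>[1/4, 3]\<close>, has slope \<open>2\<close> on \<open>[3, 7/2]\<close> (rise \<open>1\<close>), and slope
  \<open>1\<close> on \<open>[4, 7]\<close> (rise \<open>3\<close>).

  The optimal windows are then these. For \<open>\<delta> \<le> 1\<close> the window \<open>[0, \<delta>]\<close> wins: the square root beats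
  the Hoelder bound on short windows, and its total rise \<open>3/2\<close> equals the rise \<open>1 + 1/2\<close> of the
  slope \<open>2\<close> segment with the singular piece. For \<open>1 \<le> \<delta> \<le> 4\<close> the window \<open>[3, 3 + \<delta>]\<close>,
  which contains the whole singular piece, wins: a window that starts inside the piece
  gains more on the slope \<open>2\<close> segment than it loses on the slope \<open>1\<close> segment when its left end is
  moved to \<open>3\<close>; a window from the constant stretch or the slope \<open>2\<close> segment into the piece rises by at
  most \<open>3/2\<close>; and a window that reaches from the square root into the piece is
  too long to compete, because of the long constant stretch before \<open>3\<close>. For \<open>\<delta> \<ge> 4\<close> either
  \<open>[3, 7]\<close> or \<open>[0, \<delta>]\<close> wins. Consequently \<open>\<omega>\<close> is the explicit function \<open>hiding_modulus\<close>, a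
  multiple of a truncated square root plus a piecewise linear function
  (\<open>hiding_fun_increment_le\<close>, \<open>hiding_modulus_attained\<close>). Its increments are bounded by those
  of a multiple of the square root, which gives absolute continuity
  (\<open>abs_continuous_of_sqrt_bound\<close>), whereas the singular piece makes \<open>hiding_fun\<close> itself fail
  to be absolutely continuous (\<open>cantor_fun_rises_on_short_families\<close>).
\<close>

section \<open>Families of non-overlapping intervals\<close>

text \<open>
  Stated through endpoints, disjointness survives affine rescaling by linear arithmetic and gives
  the order of the intervals directly.
\<close>

lemma disjoint_open_intervals_iff:
  fixes u v :: "nat \<Rightarrow> real"
  assumes "\<forall>i<n. u i < v i"
  shows "disjoint_family_on (\<lambda>i. {u i<..<v i}) {..<n} \<longleftrightarrow>
         (\<forall>i<n. \<forall>j<n. i \<noteq> j \<longrightarrow> v i \<le> u j \<or> v j \<le> u i)"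
proof
  assume disj: "disjoint_family_on (\<lambda>i. {u i<..<v i}) {..<n}"
  show "\<forall>i<n. \<forall>j<n. i \<noteq> j \<longrightarrow> v i \<le> u j \<or> v j \<le> u i"
  proof (intro allI impI, rule ccontr)
    fix i j
    assume ij: "i < n" "j < n" "i \<noteq> j" and "\<not> (v i \<le> u j \<or> v j \<le> u i)"
    then have "max (u i) (u j) < min (v i) (v j)"
      using assms by auto
    then obtain z where "max (u i) (u j) < z" "z < min (v i) (v j)"
      using dense by blast
    then have "z \<in> {u i<..<v i} \<inter> {u j<..<v j}" by simp
    with disj ij show False unfolding disjoint_family_on_def by blast
  qed
next
  assume "\<forall>i<n. \<forall>j<n. i \<noteq> j \<longrightarrow> v i \<le> u j \<or> v j \<le> u i"
  then show "disjoint_family_on (\<lambda>i. {u i<..<v i}) {..<n}"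
    unfolding disjoint_family_on_def by fastforce
qed

text \<open>
  Removing the interval with the largest left endpoint leaves a family to the left of that
  endpoint; this is the induction step for both sum estimates below.
\<close>

lemma rightmost_interval:
  fixes u v :: "'i \<Rightarrow> real"
  assumes "finite I" "I \<noteq> {}" "\<forall>i\<in>I. u i < v i"
    and "\<forall>i\<in>I. \<forall>j\<in>I. i \<noteq> j \<longrightarrow> v i \<le> u j \<or> v j \<le> u i"
  obtains k where "k \<in> I" "\<forall>j\<in>I - {k}. v j \<le> u k"
proof -
  obtain k where k: "k \<in> I" "\<forall>j\<in>I. u j \<le> u k"
    using obtains_MAX[OF assms(1,2), of u] Max_ge[of "u ` I"] assms(1)
    by (metis finite_imageI imageI)
  have "v j \<le> u k" if "j \<in> I - {k}" for j
    using assms(3,4) k that by (metis DiffE insertI1 leD less_le_trans)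
  with k that show thesis by blast
qed

lemma sum_lengths_le:
  fixes u v :: "'i \<Rightarrow> real"
  assumes "finite I" "\<forall>i\<in>I. 0 \<le> u i \<and> u i < v i \<and> v i \<le> b" "0 \<le> b"
    and "\<forall>i\<in>I. \<forall>j\<in>I. i \<noteq> j \<longrightarrow> v i \<le> u j \<or> v j \<le> u i"
  shows "(\<Sum>i\<in>I. v i - u i) \<le> b"
  using assms
proof (induction "card I" arbitrary: I b)
  case 0
  then show ?case by simp
next
  case (Suc m)
  then have "I \<noteq> {}" by auto
  obtain k where k: "k \<in> I" "\<forall>j\<in>I - {k}. v j \<le> u k"
    by (rule rightmost_interval[of I u v]) (use Suc.prems \<open>I \<noteq> {}\<close> in auto)
  have "(\<Sum>i\<in>I - {k}. v i - u i) \<le> u k"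
    by (rule Suc.hyps(1)) (use Suc.prems Suc.hyps(2) k in auto)
  then show ?case
    using Suc.prems k by (force simp: sum.remove[of I k])
qed

lemma sqrt_increment_antimono:
  assumes "0 \<le> t" "t \<le> u" "0 \<le> d"
  shows "sqrt (u + d) - sqrt u \<le> sqrt (t + d) - sqrt t"
proof (cases "d = 0")
  case False
  have eq: "sqrt (x + d) - sqrt x = d / (sqrt (x + d) + sqrt x)" if "0 \<le> x" for x
  proof -
    have "(sqrt (x + d) - sqrt x) * (sqrt (x + d) + sqrt x) = d"
      using that assms by (simp add: algebra_simps)
    moreover have "sqrt (x + d) + sqrt x > 0"
      using that assms False by (simp add: add_pos_nonneg)
    ultimately show ?thesis by (simp add: field_simps)
  qed
  have "d / (sqrt (u + d) + sqrt u) \<le> d / (sqrt (t + d) + sqrt t)"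
    using assms False by (intro divide_left_mono mult_pos_pos add_mono add_pos_nonneg) auto
  then show ?thesis using eq assms by simp
qed simp

text \<open>
  By concavity the sum of increments grows when the intervals are pushed together towards \<open>0\<close>,
  where it telescopes. In the induction, the intervals other than the rightmost one have total
  length \<open>T\<close> at most the left endpoint of the rightmost one, which may therefore be moved to
  start at \<open>T\<close>.
\<close>

lemma sum_sqrt_increments_le:
  fixes u v :: "'i \<Rightarrow> real"
  assumes "finite I" "\<forall>i\<in>I. 0 \<le> u i \<and> u i < v i"
    and "\<forall>i\<in>I. \<forall>j\<in>I. i \<noteq> j \<longrightarrow> v i \<le> u j \<or> v j \<le> u i"
  shows "(\<Sum>i\<in>I. sqrt (v i) - sqrt (u i)) \<le> sqrt (\<Sum>i\<in>I. v i - u i)"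
  using assms
proof (induction "card I" arbitrary: I)
  case 0
  then show ?case by simp
next
  case (Suc m)
  then have "I \<noteq> {}" by auto
  obtain k where k: "k \<in> I" "\<forall>j\<in>I - {k}. v j \<le> u k"
    by (rule rightmost_interval[of I u v]) (use Suc.prems \<open>I \<noteq> {}\<close> in auto)
  define T where "T = (\<Sum>i\<in>I - {k}. v i - u i)"
  have "T \<le> u k"
    unfolding T_def by (rule sum_lengths_le) (use Suc.prems k in auto)
  moreover have "0 \<le> T"
    unfolding T_def using Suc.prems by (intro sum_nonneg) (auto intro: less_imp_le)
  ultimately have "sqrt (u k + (v k - u k)) - sqrt (u k) \<le> sqrt (T + (v k - u k)) - sqrt T"
    using Suc.prems(2) k(1) by (intro sqrt_increment_antimono) (auto intro: less_imp_le)
  moreover have "(\<Sum>i\<in>I - {k}. sqrt (v i) - sqrt (u i)) \<le> sqrt T"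
    unfolding T_def by (rule Suc.hyps(1)) (use Suc.prems Suc.hyps(2) k in auto)
  ultimately show ?case
    using Suc.prems k by (simp add: sum.remove[of I k] T_def add.commute)
qed

lemma abs_continuous_of_sqrt_bound:
  assumes "0 \<le> a" "K > 0"
    and bound: "\<And>u v. a \<le> u \<Longrightarrow> u < v \<Longrightarrow> v \<le> b \<Longrightarrow> \<bar>g v - g u\<bar> \<le> K * (sqrt v - sqrt u)"
  shows "abs_continuous_on_interval a b g"
  unfolding abs_continuous_on_interval_def
proof (intro allI impI)
  fix \<epsilon> :: real assume "\<epsilon> > 0"
  show "\<exists>\<delta>>0. \<forall>(n::nat) u v. (\<forall>i<n. a \<le> u i \<and> u i < v i \<and> v i \<le> b) \<longrightarrow>
        disjoint_family_on (\<lambda>i. {u i<..<v i}) {..<n} \<longrightarrow>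
        (\<Sum>i<n. v i - u i) < \<delta> \<longrightarrow> (\<Sum>i<n. \<bar>g (v i) - g (u i)\<bar>) < \<epsilon>"
  proof (intro exI[of _ "(\<epsilon> / K)\<^sup>2"] conjI allI impI)
    show "(\<epsilon> / K)\<^sup>2 > 0" using \<open>\<epsilon> > 0\<close> assms(2) by simp
    fix n :: nat and u v :: "nat \<Rightarrow> real"
    assume uv: "\<forall>i<n. a \<le> u i \<and> u i < v i \<and> v i \<le> b"
      and disj: "disjoint_family_on (\<lambda>i. {u i<..<v i}) {..<n}"
      and len: "(\<Sum>i<n. v i - u i) < (\<epsilon> / K)\<^sup>2"
    have "(\<Sum>i<n. \<bar>g (v i) - g (u i)\<bar>) \<le> (\<Sum>i<n. K * (sqrt (v i) - sqrt (u i)))"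
      by (rule sum_mono) (use uv bound in auto)
    also have "\<dots> = K * (\<Sum>i<n. sqrt (v i) - sqrt (u i))"
      by (simp add: sum_distrib_left)
    also have "\<dots> \<le> K * sqrt (\<Sum>i<n. v i - u i)"
    proof (intro mult_left_mono sum_sqrt_increments_le)
      show "\<forall>i\<in>{..<n}. \<forall>j\<in>{..<n}. i \<noteq> j \<longrightarrow> v i \<le> u j \<or> v j \<le> u i"
        using disjoint_open_intervals_iff[of n u v] uv disj by simp
    qed (use uv assms in \<open>auto intro: order_trans\<close>)
    also have "\<dots> < K * sqrt ((\<epsilon> / K)\<^sup>2)"
      using len assms(2) by (intro mult_strict_left_mono real_sqrt_less_mono)
    also have "\<dots> = \<epsilon>"
      using \<open>\<epsilon> > 0\<close> assms(2) by simp
    finally show "(\<Sum>i<n. \<bar>g (v i) - g (u i)\<bar>) < \<epsilon>" .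
  qed
qed

section \<open>A singular function\<close>

text \<open>
  The Cantor function is the fixed point of \<open>g \<mapsto> (\<lambda>x. (g (4 * x) + g (4 * x - 3)) / 2)\<close> with values
  \<open>0\<close> left of \<open>0\<close> and \<open>1\<close> right of \<open>1\<close>. This operator is monotone, and it
  maps the indicator function of the positive reals below itself; so the iterates decrease
  pointwise and converge.
\<close>

primrec cantor_approx :: "nat \<Rightarrow> real \<Rightarrow> real" where
  "cantor_approx 0 x = (if x > 0 then 1 else 0)"
| "cantor_approx (Suc n) x = (cantor_approx n (4 * x) + cantor_approx n (4 * x - 3)) / 2"

definition cantor_fun :: "real \<Rightarrow> real" where
  "cantor_fun x = lim (\<lambda>n. cantor_approx n x)"

lemma cantor_approx_mono: "x \<le> y \<Longrightarrow> cantor_approx n x \<le> cantor_approx n y"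
  by (induction n arbitrary: x y) (auto intro!: add_mono divide_right_mono)

lemma cantor_approx_left: "x \<le> 0 \<Longrightarrow> cantor_approx n x = 0"
  by (induction n arbitrary: x) auto

lemma cantor_approx_right: "1 \<le> x \<Longrightarrow> cantor_approx n x = 1"
  by (induction n arbitrary: x) auto

lemma cantor_approx_nonneg: "0 \<le> cantor_approx n x"
  by (induction n arbitrary: x) auto

lemma cantor_approx_Suc_le: "cantor_approx (Suc n) x \<le> cantor_approx n x"
proof (induction n arbitrary: x)
  case (Suc n)
  show ?case
    using Suc.IH[of "4 * x"] Suc.IH[of "4 * x - 3"] unfolding cantor_approx.simps(2)[of "Suc n"]
      cantor_approx.simps(2)[of n x] by (intro divide_right_mono add_mono) auto
qed auto

lemma cantor_approx_tendsto: "(\<lambda>n. cantor_approx n x) \<longlonglongrightarrow> cantor_fun x"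
proof -
  have "decseq (\<lambda>n. cantor_approx n x)"
    by (intro decseq_SucI cantor_approx_Suc_le)
  then have "convergent (\<lambda>n. cantor_approx n x)"
    using decseq_convergent[of _ 0] cantor_approx_nonneg convergentI by metis
  then show ?thesis
    unfolding cantor_fun_def by (simp add: convergent_LIMSEQ_iff)
qed

lemma cantor_fun_mono: "x \<le> y \<Longrightarrow> cantor_fun x \<le> cantor_fun y"
  by (rule LIMSEQ_le[OF cantor_approx_tendsto cantor_approx_tendsto])
     (use cantor_approx_mono in blast)

lemma cantor_fun_left: "x \<le> 0 \<Longrightarrow> cantor_fun x = 0"
  using cantor_approx_tendsto[of x] by (simp add: cantor_approx_left LIMSEQ_const_iff)

lemma cantor_fun_right: "1 \<le> x \<Longrightarrow> cantor_fun x = 1"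
  using cantor_approx_tendsto[of x] by (simp add: cantor_approx_right LIMSEQ_const_iff)

lemma cantor_fun_range: "0 \<le> cantor_fun x" "cantor_fun x \<le> 1"
  using cantor_fun_mono[of "min x 0" x] cantor_fun_mono[of x "max x 1"]
  by (auto simp: cantor_fun_left cantor_fun_right)

lemma cantor_fun_self_similar: "cantor_fun x = (cantor_fun (4 * x) + cantor_fun (4 * x - 3)) / 2"
proof (rule LIMSEQ_unique)
  show "(\<lambda>n. cantor_approx (Suc n) x) \<longlonglongrightarrow> cantor_fun x"
    by (rule LIMSEQ_Suc[OF cantor_approx_tendsto])
  show "(\<lambda>n. cantor_approx (Suc n) x) \<longlonglongrightarrow> (cantor_fun (4 * x) + cantor_fun (4 * x - 3)) / 2"
    unfolding cantor_approx.simps by (intro tendsto_intros cantor_approx_tendsto) auto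
qed

text \<open>
  The factor \<open>1/2\<close> in the values is the square root of the factor \<open>1/4\<close> in the arguments, so the
  bound \<open>2 * sqrt (y - x)\<close> is invariant under the self-similarity as long as only one of the two
  halves contributes. If both contribute, \<open>y - x \<ge> 1/2\<close> and the bound exceeds \<open>1\<close>. The error term
  starts the induction with the trivial bound \<open>1\<close> and is halved in each step.
\<close>

lemma cantor_fun_holder_approx:
  "x \<le> y \<Longrightarrow> cantor_fun y - cantor_fun x \<le> 2 * sqrt (y - x) + (1/2) ^ n"
proof (induction n arbitrary: x y)
  case 0
  then have "0 \<le> sqrt (y - x)" by simp
  then show ?case
    using cantor_fun_range[of x] cantor_fun_range[of y] unfolding power_0 by linarith
next
  case (Suc n)
  note ss = cantor_fun_self_similar[of x] cantor_fun_self_similar[of y]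
  have scale: "sqrt (4 * y - 4 * x) = 2 * sqrt (y - x)"
    using real_sqrt_mult[of 4 "y - x"] by (simp add: algebra_simps)
  consider "3/4 \<le> y" "x \<le> 1/4" | "y \<le> 3/4" | "1/4 \<le> x" by linarith
  then show ?case
  proof cases
    case 1
    have "1/2 = sqrt (1/4)" by (simp add: real_sqrt_divide)
    also have "\<dots> \<le> sqrt (y - x)" using 1 by (intro real_sqrt_le_mono) simp
    moreover have "(0::real) < (1/2) ^ Suc n" by simp
    ultimately show ?thesis
      using cantor_fun_range[of x] cantor_fun_range[of y] by linarith
  next
    case 2
    then show ?thesis
      using ss Suc.IH[of "4 * x" "4 * y"] Suc.prems scale by (simp add: cantor_fun_left)
  next
    case 3
    then show ?thesis
      using ss Suc.IH[of "4 * x - 3" "4 * y - 3"] Suc.prems scale by (simp add: cantor_fun_right)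
  qed
qed

lemma cantor_fun_holder:
  assumes "x \<le> y"
  shows "cantor_fun y - cantor_fun x \<le> 2 * sqrt (y - x)"
proof (rule LIMSEQ_le_const)
  show "(\<lambda>n. 2 * sqrt (y - x) + (1/2) ^ n) \<longlonglongrightarrow> 2 * sqrt (y - x)"
    by (rule tendsto_eq_intros LIMSEQ_power_zero refl | simp)+
qed (use cantor_fun_holder_approx[OF assms] in blast)

lemma continuous_on_cantor_fun: "continuous_on A cantor_fun"
proof -
  have "isCont cantor_fun x" for x
    unfolding isCont_def
  proof (rule LIM_zero_cancel, rule Lim_null_comparison)
    show "\<forall>\<^sub>F y in at x. norm (cantor_fun y - cantor_fun x) \<le> 2 * sqrt \<bar>y - x\<bar>"
    proof (intro always_eventually allI)
      fix y
      show "norm (cantor_fun y - cantor_fun x) \<le> 2 * sqrt \<bar>y - x\<bar>"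
        using cantor_fun_holder[of x y] cantor_fun_holder[of y x]
          cantor_fun_mono[of x y] cantor_fun_mono[of y x] by (cases "x \<le> y") auto
    qed
    show "((\<lambda>y. 2 * sqrt \<bar>y - x\<bar>) \<longlongrightarrow> 0) (at x)"
      by (rule tendsto_eq_intros refl | simp)+
  qed
  then show ?thesis by (simp add: continuous_at_imp_continuous_on)
qed

lemma sum_lessThan_append:
  fixes p q :: "nat \<Rightarrow> real"
  shows "(\<Sum>i<N + N. if i < N then p i else q (i - N)) = (\<Sum>i<N. p i) + (\<Sum>i<N. q i)"
proof -
  have "(\<Sum>i<N + M. if i < N then p i else q (i - N)) = (\<Sum>i<N. p i) + (\<Sum>i<M. q i)" for M
    by (induction M) auto
  then show ?thesis .
qed

text \<open>
  The \<open>2 ^ n\<close> intervals of stage \<open>n\<close> of the Cantor construction, each of length \<open>(1/4) ^ n\<close>: the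
  next stage consists of the copies of this one in \<open>[0, 1/4]\<close> and \<open>[3/4, 1]\<close>, each of which has
  a quarter of the length and half of the rise.
\<close>

lemma cantor_fun_rises_on_short_families:
  "\<exists>N u v. (\<forall>i<N. 0 \<le> u i \<and> u i < v i \<and> v i \<le> 1) \<and>
     (\<forall>i<N. \<forall>j<N. i \<noteq> j \<longrightarrow> v i \<le> u j \<or> v j \<le> u i) \<and>
     (\<Sum>i<(N::nat). v i - u i) = (1/2) ^ n \<and> (\<Sum>i<N. cantor_fun (v i) - cantor_fun (u i)) = 1"
proof (induction n)
  case 0
  show ?case
    by (intro exI[of _ 1] exI[of _ "\<lambda>_. 0"] exI[of _ "\<lambda>_. 1"])
       (simp add: cantor_fun_left cantor_fun_right)
next
  case (Suc n)
  then obtain N :: nat and u v where uv: "\<forall>i<N. 0 \<le> u i \<and> u i < v i \<and> v i \<le> 1"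
    and sep: "\<forall>i<N. \<forall>j<N. i \<noteq> j \<longrightarrow> v i \<le> u j \<or> v j \<le> u i"
    and len: "(\<Sum>i<N. v i - u i) = (1/2) ^ n"
    and rise: "(\<Sum>i<N. cantor_fun (v i) - cantor_fun (u i)) = 1"
    by blast
  \<comment> \<open>Indices below \<open>N\<close> number the left copy, the remaining ones the right copy.\<close>
  define copies :: "(nat \<Rightarrow> real) \<Rightarrow> nat \<Rightarrow> real"
    where "copies w i = (if i < N then w i / 4 else (w (i - N) + 3) / 4)" for w i
  have left: "cantor_fun (x / 4) = cantor_fun x / 2"
    and right: "cantor_fun ((x + 3) / 4) = (1 + cantor_fun x) / 2" if "0 \<le> x" "x \<le> 1" for x
  proof -
    have "4 * ((x + 3) / 4) = x + 3" by simp
    then show "cantor_fun (x / 4) = cantor_fun x / 2"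
      "cantor_fun ((x + 3) / 4) = (1 + cantor_fun x) / 2"
      using that cantor_fun_self_similar[of "x / 4"] cantor_fun_self_similar[of "(x + 3) / 4"]
      by (simp_all only: cantor_fun_left cantor_fun_right) (simp_all add: cantor_fun_left cantor_fun_right)
  qed
  have bounds: "\<forall>i<N + N. 0 \<le> copies u i \<and> copies u i < copies v i \<and> copies v i \<le> 1"
  proof (intro allI impI)
    fix i assume "i < N + N"
    then show "0 \<le> copies u i \<and> copies u i < copies v i \<and> copies v i \<le> 1"
      using uv[rule_format, of i] uv[rule_format, of "i - N"]
      by (cases "i < N") (auto simp: copies_def)
  qed
  have seps: "\<forall>i<N + N. \<forall>j<N + N. i \<noteq> j \<longrightarrow>
      copies v i \<le> copies u j \<or> copies v j \<le> copies u i"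
  proof (intro allI impI)
    fix i j assume ij: "i < N + N" "j < N + N" "i \<noteq> j"
    show "copies v i \<le> copies u j \<or> copies v j \<le> copies u i"
    proof (cases "i < N"; cases "j < N")
      assume "i < N" "j < N"
      then show ?thesis using sep[rule_format, of i j] ij by (auto simp: copies_def)
    next
      assume c: "i < N" "\<not> j < N"
      then have "j - N < N" using ij by linarith
      then show ?thesis
        using c uv[rule_format, of i] uv[rule_format, of "j - N"] by (auto simp: copies_def)
    next
      assume c: "\<not> i < N" "j < N"
      then have "i - N < N" using ij by linarith
      then show ?thesis
        using c uv[rule_format, of j] uv[rule_format, of "i - N"] by (auto simp: copies_def)
    next
      assume c: "\<not> i < N" "\<not> j < N"
      then have "i - N < N" "j - N < N" "i - N \<noteq> j - N" using ij by linarith+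
      then show ?thesis
        using c sep[rule_format, of "i - N" "j - N"] by (auto simp: copies_def)
    qed
  qed
  have "(\<Sum>i<N + N. copies v i - copies u i) =
      (\<Sum>i<N + N. if i < N then (v i - u i) / 4 else (v (i - N) - u (i - N)) / 4)"
    by (rule sum.cong) (auto simp: copies_def field_simps)
  also have "\<dots> = (\<Sum>i<N. (v i - u i) / 4) + (\<Sum>i<N. (v i - u i) / 4)"
    by (rule sum_lessThan_append)
  also have "\<dots> = (1/2) ^ Suc n"
    using len by (simp add: sum_divide_distrib[symmetric])
  finally have lens: "(\<Sum>i<N + N. copies v i - copies u i) = (1/2) ^ Suc n" .
  have "(\<Sum>i<N + N. cantor_fun (copies v i) - cantor_fun (copies u i)) =
      (\<Sum>i<N + N. if i < N then (cantor_fun (v i) - cantor_fun (u i)) / 2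
        else (cantor_fun (v (i - N)) - cantor_fun (u (i - N))) / 2)"
  proof (rule sum.cong)
    fix i assume i: "i \<in> {..<N + N}"
    show "cantor_fun (copies v i) - cantor_fun (copies u i) =
      (if i < N then (cantor_fun (v i) - cantor_fun (u i)) / 2
        else (cantor_fun (v (i - N)) - cantor_fun (u (i - N))) / 2)"
    proof (cases "i < N")
      case True
      with uv[rule_format, of i] show ?thesis
        by (simp add: copies_def left diff_divide_distrib)
    next
      case False
      then have "i - N < N" using i by auto
      then have "0 \<le> u (i - N)" "u (i - N) \<le> 1" "0 \<le> v (i - N)" "v (i - N) \<le> 1"
        using uv[rule_format, of "i - N"] by auto
      note right[OF this(1,2)] right[OF this(3,4)]
      then show ?thesis
        using False unfolding copies_def by (simp only: if_False) (simp add: field_simps)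
    qed
  qed simp
  also have "\<dots> = (\<Sum>i<N. (cantor_fun (v i) - cantor_fun (u i)) / 2) +
      (\<Sum>i<N. (cantor_fun (v i) - cantor_fun (u i)) / 2)"
    by (rule sum_lessThan_append)
  also have "\<dots> = 1"
    using rise by (simp add: sum_divide_distrib[symmetric])
  finally have "(\<Sum>i<N + N. cantor_fun (copies v i) - cantor_fun (copies u i)) = 1" .
  with bounds seps lens show ?case by blast
qed

section \<open>A function whose modulus of continuity hides its singular part\<close>

definition hiding_fun :: "real \<Rightarrow> real" where
  "hiding_fun x = 3 * sqrt (min x (1/4)) + 2 * max 0 (min (x - 3) (1/2))
     + cantor_fun (2 * x - 7) / 2 + max 0 (x - 4)"

definition hiding_modulus :: "real \<Rightarrow> real" where
  "hiding_modulus d = 3 * sqrt (min d (1/4)) + max 0 (min (d - 1) 3) + max 0 (d - 11/2)"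

lemma sqrt_quarter [simp]: "sqrt (1/4) = 1/2"
  by (simp add: real_sqrt_divide)

lemma hiding_fun_mono: "x \<le> y \<Longrightarrow> hiding_fun x \<le> hiding_fun y"
  unfolding hiding_fun_def
  by (intro add_mono mult_left_mono real_sqrt_le_mono divide_right_mono cantor_fun_mono) auto

lemma continuous_on_hiding_fun: "continuous_on A hiding_fun"
  unfolding hiding_fun_def
  by (intro continuous_intros continuous_on_compose2[OF continuous_on_cantor_fun[of UNIV]]) auto

text \<open>
  The increment splits into the contributions \<open>3 * S\<close> of the square root, \<open>2 * L\<close> of the slope
  \<open>2\<close> segment, \<open>C / 2\<close> of the singular piece and \<open>R\<close> of the slope \<open>1\<close> segment. For long windows
  it is enough that \<open>C \<le> 1\<close>. Windows shorter than \<open>1/4\<close> need the modulus of \<open>C\<close>: the Hoelder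
  bound makes \<open>C / 2\<close> at most \<open>2 * sqrt d\<close> and leaves \<open>sqrt d\<close> for the two
  linear segments.
\<close>

lemma hiding_fun_increment_le:
  assumes "0 \<le> x" "x \<le> y" "y \<le> 7"
  shows "hiding_fun y - hiding_fun x \<le> hiding_modulus (y - x)"
proof -
  define d where "d = y - x"
  define S where "S = sqrt (min y (1/4)) - sqrt (min x (1/4))"
  define L where "L = max 0 (min (y - 3) (1/2)) - max 0 (min (x - 3) (1/2))"
  define C where "C = cantor_fun (2 * y - 7) - cantor_fun (2 * x - 7)"
  define R where "R = max 0 (y - 4) - max 0 (x - 4)"
  have inc: "hiding_fun y - hiding_fun x = 3 * S + 2 * L + C / 2 + R"
    by (simp add: hiding_fun_def S_def L_def C_def R_def)
  have C: "C \<le> 1"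
    using cantor_fun_range[of "2 * y - 7"] cantor_fun_range[of "2 * x - 7"] by (simp add: C_def)
  have "0 \<le> sqrt (min x (1/4))" using assms by simp
  moreover have "sqrt (min y (1/4)) \<le> 1/2"
    using real_sqrt_le_mono[of "min y (1/4)" "1/4"] by simp
  ultimately have S: "S \<le> 1/2" unfolding S_def by linarith
  have S0: "S = 0" if "1/4 \<le> x" using that assms by (simp add: S_def)
  have quarter: "hiding_modulus d = 3/2 + max 0 (min (d - 1) 3) + max 0 (d - 11/2)" if "1/4 \<le> d"
    using that by (simp add: hiding_modulus_def)
  consider "d \<le> 1" "x < 1/4" | "d < 1/4" "1/4 \<le> x" | "1/4 \<le> d" "d \<le> 1" "1/4 \<le> x"
    | "1 \<le> d" "d \<le> 4" "1/4 \<le> x" | "1 \<le> d" "d \<le> 4" "x < 1/4"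
    | "4 \<le> d" "1/4 \<le> x" | "4 \<le> d" "x < 1/4" by linarith
  then have "3 * S + 2 * L + C / 2 + R \<le> hiding_modulus d"
  proof cases
    case 1
    then have y: "y < 3" by (simp add: d_def)
    then have "C = 0" "L = 0" "R = 0"
      using assms by (auto simp: C_def L_def R_def cantor_fun_left)
    moreover have "S \<le> sqrt (min d (1/4))"
    proof -
      have "sqrt (min y (1/4)) \<le> sqrt (min x (1/4) + min d (1/4))"
        using assms by (intro real_sqrt_le_mono) (auto simp: d_def)
      also have "\<dots> \<le> sqrt (min x (1/4)) + sqrt (min d (1/4))"
        using assms by (intro sqrt_add_le_add_sqrt) (auto simp: d_def)
      finally show ?thesis by (simp add: S_def)
    qed
    ultimately show ?thesis using 1 by (simp add: hiding_modulus_def)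
  next
    case 2
    have d0: "0 \<le> d" using assms by (simp add: d_def)
    have "2 * L + R \<le> 2 * d"
      using assms by (simp add: L_def R_def d_def max_def min_def)
    also have "d \<le> sqrt d / 2"
    proof -
      have "d = sqrt d * sqrt d" using d0 by simp
      also have "\<dots> \<le> (1/2) * sqrt d"
        using 2 d0 real_sqrt_le_mono[of d "1/4"] by (intro mult_right_mono) auto
      finally show ?thesis by simp
    qed
    finally have LR: "2 * L + R \<le> sqrt d" by simp
    have "C \<le> 2 * sqrt (2 * d)"
      using cantor_fun_holder[of "2 * x - 7" "2 * y - 7"] assms by (simp add: C_def d_def)
    also have "sqrt (2 * d) \<le> sqrt (4 * d)"
      using d0 by (intro real_sqrt_le_mono) simp
    also have "\<dots> = 2 * sqrt d" by (simp add: real_sqrt_mult)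
    finally have "C / 2 \<le> 2 * sqrt d" by simp
    with LR S0 2 show ?thesis by (simp add: hiding_modulus_def)
  next
    case 3
    have "2 * L + R \<le> 1"
      using 3 assms by (auto simp: L_def R_def d_def max_def min_def)
    then show ?thesis using quarter S0 3 C by simp
  next
    case 4
    have "2 * L + R \<le> d"
      using 4 assms by (auto simp: L_def R_def d_def max_def min_def)
    then show ?thesis using quarter S0 4 C by simp
  next
    case 5
    show ?thesis
    proof (cases "y \<le> 3")
      case True
      then have "C = 0" "L = 0" "R = 0"
        using assms by (auto simp: C_def L_def R_def cantor_fun_left)
      then show ?thesis using quarter 5 S by simp
    next
      case False
      \<comment> \<open>Here \<open>d > 11/4\<close>, and either \<open>R = 0\<close> and \<open>2 * L \<le> 1\<close>, or \<open>2 * L + R = y - 3 < d - 11/4\<close>.\<close>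
      then have "2 * L + R \<le> d - 3/2"
        using 5 assms by (auto simp: L_def R_def d_def max_def min_def)
      then show ?thesis using quarter 5 S C by simp
    qed
  next
    case 6
    have "2 * L + R \<le> 4"
      using 6 assms by (auto simp: L_def R_def d_def max_def min_def)
    then show ?thesis using quarter S0 6 C by simp
  next
    case 7
    \<comment> \<open>Moving the left end from \<open>0\<close> to \<open>x\<close> loses \<open>3 * sqrt x\<close>, at least the length lost.\<close>
    have "x \<le> 3 * sqrt x"
    proof -
      have "x = sqrt x * sqrt x" using assms by simp
      also have "\<dots> \<le> 3 * sqrt x"
        using 7 assms real_sqrt_le_mono[of x "1/4"] by (intro mult_right_mono) auto
      finally show ?thesis .
    qed
    moreover have "S = 1/2 - sqrt x"
      using 7 assms by (simp add: S_def d_def)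
    moreover have "L = 1/2" "R = y - 4"
      using 7 assms by (auto simp: L_def R_def d_def)
    ultimately have "3 * S + 2 * L + C / 2 + R \<le> d - 1"
      using C by (simp add: d_def)
    also have "\<dots> \<le> hiding_modulus d" using quarter 7 by simp
    finally show ?thesis .
  qed
  then show ?thesis unfolding inc d_def .
qed

lemma hiding_modulus_attained:
  assumes "0 \<le> d" "d \<le> 7"
  shows "\<exists>x y. 0 \<le> x \<and> x \<le> y \<and> y \<le> 7 \<and> y - x \<le> d \<and> hiding_fun y - hiding_fun x = hiding_modulus d"
proof -
  consider "d \<le> 1" | "1 \<le> d" "d \<le> 4" | "4 \<le> d" "d \<le> 11/2" | "11/2 \<le> d" by linarith
  then show ?thesis
  proof cases
    case 1
    then show ?thesis using assms
      by (intro exI[of _ 0] exI[of _ d])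
         (auto simp: hiding_fun_def hiding_modulus_def cantor_fun_left)
  next
    case 2
    then show ?thesis using assms
      by (intro exI[of _ 3] exI[of _ "3 + d"])
         (auto simp: hiding_fun_def hiding_modulus_def cantor_fun_left cantor_fun_right)
  next
    case 3
    then show ?thesis using assms
      by (intro exI[of _ 3] exI[of _ 7])
         (auto simp: hiding_fun_def hiding_modulus_def cantor_fun_left cantor_fun_right)
  next
    case 4
    then show ?thesis using assms
      by (intro exI[of _ 0] exI[of _ d])
         (auto simp: hiding_fun_def hiding_modulus_def cantor_fun_left cantor_fun_right)
  qed
qed

lemma hiding_modulus_mono: "d \<le> d' \<Longrightarrow> hiding_modulus d \<le> hiding_modulus d'"
  unfolding hiding_modulus_def by (intro add_mono mult_left_mono real_sqrt_le_mono) auto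

lemma min_modulus_hiding_fun:
  assumes "0 \<le> d" "d \<le> 7"
  shows "min_modulus 0 7 hiding_fun d = hiding_modulus d"
  unfolding min_modulus_def
proof (rule cSup_eq_maximum)
  obtain x y where xy: "0 \<le> x" "x \<le> y" "y \<le> 7" "y - x \<le> d"
    "hiding_fun y - hiding_fun x = hiding_modulus d"
    using hiding_modulus_attained[OF assms] by blast
  then have "hiding_modulus d = \<bar>hiding_fun y - hiding_fun x\<bar>"
    using hiding_fun_mono[of x y] by simp
  moreover have "y \<in> {0..7}" "x \<in> {0..7}" "\<bar>y - x\<bar> \<le> d"
    using xy by auto
  ultimately show "hiding_modulus d \<in> {\<bar>hiding_fun x - hiding_fun y\<bar> | x y.
      x \<in> {0..7} \<and> y \<in> {0..7} \<and> \<bar>x - y\<bar> \<le> d}"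
    by blast
next
  have le: "hiding_fun y - hiding_fun x \<le> hiding_modulus d"
    if "0 \<le> x" "x \<le> y" "y \<le> 7" "y - x \<le> d" for x y
    using hiding_fun_increment_le[OF that(1-3)] hiding_modulus_mono[OF that(4)] by linarith
  fix z
  assume "z \<in> {\<bar>hiding_fun x - hiding_fun y\<bar> | x y. x \<in> {0..7} \<and> y \<in> {0..7} \<and> \<bar>x - y\<bar> \<le> d}"
  then obtain x y where z: "z = \<bar>hiding_fun x - hiding_fun y\<bar>"
    and xy: "x \<in> {0..7}" "y \<in> {0..7}" "\<bar>x - y\<bar> \<le> d"
    by blast
  show "z \<le> hiding_modulus d"
    using z xy le[of x y] le[of y x] hiding_fun_mono[of x y] hiding_fun_mono[of y x]
    by (cases "x \<le> y") auto
qed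

lemma hiding_modulus_increment_le:
  assumes "0 \<le> u" "u < v" "v \<le> 7"
  shows "\<bar>hiding_modulus v - hiding_modulus u\<bar> \<le> 15 * (sqrt v - sqrt u)"
proof -
  \<comment> \<open>\<open>sqrt 7 \<le> 3\<close> turns the two Lipschitz summands into \<open>12 = 2 * (3 + 3)\<close>, and the square root
    summand contributes \<open>3\<close>.\<close>
  have "v - u = (sqrt v + sqrt u) * (sqrt v - sqrt u)"
    using assms by (simp add: algebra_simps)
  also have "\<dots> \<le> (3 + 3) * (sqrt v - sqrt u)"
    using assms by (intro mult_right_mono add_mono real_le_lsqrt) auto
  finally have "2 * (v - u) \<le> 12 * (sqrt v - sqrt u)" by simp
  moreover have "sqrt (min v (1/4)) - sqrt (min u (1/4)) \<le> sqrt v - sqrt u"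
    using assms real_sqrt_le_mono[of "1/4" v] real_sqrt_le_mono[of u v]
    by (auto simp: min_def)
  moreover have "max 0 (min (v - 1) 3) - max 0 (min (u - 1) 3) \<le> v - u"
    "max 0 (v - 11/2) - max 0 (u - 11/2) \<le> v - u"
    using assms by (auto simp: max_def min_def)
  ultimately have "hiding_modulus v - hiding_modulus u \<le> 15 * (sqrt v - sqrt u)"
    unfolding hiding_modulus_def by argo
  then show ?thesis using hiding_modulus_mono[of u v] assms by simp
qed

lemma abs_continuous_min_modulus_hiding_fun:
  "abs_continuous_on_interval 0 7 (min_modulus 0 7 hiding_fun)"
proof (rule abs_continuous_of_sqrt_bound[of 0 15])
  fix u v :: real assume "0 \<le> u" "u < v" "v \<le> 7"
  then show "\<bar>min_modulus 0 7 hiding_fun v - min_modulus 0 7 hiding_fun u\<bar> \<le> 15 * (sqrt v - sqrt u)"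
    using hiding_modulus_increment_le[of u v] by (simp add: min_modulus_hiding_fun)
qed auto

lemma not_abs_continuous_hiding_fun: "\<not> abs_continuous_on_interval 0 7 hiding_fun"
proof
  assume "abs_continuous_on_interval 0 7 hiding_fun"
  then obtain \<delta> where "\<delta> > 0" and ac: "\<And>(n::nat) u v.
      \<forall>i<n. 0 \<le> u i \<and> u i < v i \<and> v i \<le> 7 \<Longrightarrow>
      disjoint_family_on (\<lambda>i. {u i<..<v i}) {..<n} \<Longrightarrow> (\<Sum>i<n. v i - u i) < \<delta> \<Longrightarrow>
      (\<Sum>i<n. \<bar>hiding_fun (v i) - hiding_fun (u i)\<bar>) < 1/2"
    unfolding abs_continuous_on_interval_def
    by (drule_tac x = "1/2" in spec) auto
  obtain n where n: "(1/2::real) ^ n < \<delta>"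
    using real_arch_pow_inv[of \<delta> "1/2"] \<open>\<delta> > 0\<close> by auto
  obtain N :: nat and u v where uv: "\<forall>i<N. 0 \<le> u i \<and> u i < v i \<and> v i \<le> 1"
    and sep: "\<forall>i<N. \<forall>j<N. i \<noteq> j \<longrightarrow> v i \<le> u j \<or> v j \<le> u i"
    and len: "(\<Sum>i<N. v i - u i) = (1/2) ^ n"
    and rise: "(\<Sum>i<N. cantor_fun (v i) - cantor_fun (u i)) = 1"
    using cantor_fun_rises_on_short_families[of n] by blast
  define w where "w x = (x + 7) / 2" for x :: real
  have arg: "2 * w x - 7 = x" for x by (simp add: w_def field_simps)
  \<comment> \<open>On \<open>[7/2, 4]\<close> the singular summand is the only one that varies.\<close>
  have on_singular_piece: "hiding_fun (w x) = 5/2 + cantor_fun x / 2" if "0 \<le> x" "x \<le> 1" for x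
    using that by (simp add: hiding_fun_def arg) (simp add: w_def)
  have "(\<Sum>i<N. \<bar>hiding_fun (w (v i)) - hiding_fun (w (u i))\<bar>) < 1/2"
  proof (rule ac)
    show bounds: "\<forall>i<N. 0 \<le> w (u i) \<and> w (u i) < w (v i) \<and> w (v i) \<le> 7"
      using uv by (force simp: w_def)
    show "disjoint_family_on (\<lambda>i. {w (u i)<..<w (v i)}) {..<N}"
      using disjoint_open_intervals_iff[of N "\<lambda>i. w (u i)" "\<lambda>i. w (v i)"] bounds sep
      by (simp add: w_def)
    have "(\<Sum>i<N. w (v i) - w (u i)) = (\<Sum>i<N. v i - u i) / 2"
      by (simp add: w_def sum_divide_distrib diff_divide_distrib[symmetric])
    then show "(\<Sum>i<N. w (v i) - w (u i)) < \<delta>"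
      using len n \<open>\<delta> > 0\<close> by linarith
  qed
  moreover have "(\<Sum>i<N. \<bar>hiding_fun (w (v i)) - hiding_fun (w (u i))\<bar>) \<ge>
      (\<Sum>i<N. (cantor_fun (v i) - cantor_fun (u i)) / 2)"
  proof (rule sum_mono)
    fix i assume "i \<in> {..<N}"
    then have "0 \<le> u i" "u i < v i" "v i \<le> 1" using uv by auto
    then show "(cantor_fun (v i) - cantor_fun (u i)) / 2
        \<le> \<bar>hiding_fun (w (v i)) - hiding_fun (w (u i))\<bar>"
      using cantor_fun_mono[of "u i" "v i"] by (simp add: on_singular_piece diff_divide_distrib)
  qed
  ultimately show False using rise by (simp add: sum_divide_distrib[symmetric])
qed

theorem theorem2p1:
  shows "\<exists>f :: real \<Rightarrow> real.
           f \<in> {0..7} \<rightarrow> {0..7} \<and>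
           mono_on {0..7} f \<and>
           continuous_on {0..7} f \<and>
           \<not> abs_continuous_on_interval 0 7 f \<and>
           abs_continuous_on_interval 0 7 (min_modulus 0 7 f)"
proof (intro exI conjI)
  have "hiding_fun 0 = 0" "hiding_fun 7 = 6"
    by (auto simp: hiding_fun_def cantor_fun_left cantor_fun_right)
  then show "hiding_fun \<in> {0..7} \<rightarrow> {0..7}"
    using hiding_fun_mono[of 0] hiding_fun_mono[of _ 7] by force
  show "mono_on {0..7} hiding_fun"
    using hiding_fun_mono by (auto intro: mono_onI)
qed (rule continuous_on_hiding_fun not_abs_continuous_hiding_fun
       abs_continuous_min_modulus_hiding_fun)+

end
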